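(* Let $d$ be a positive integer. For positive integers $n,p$ let $\mathbf{X}_{n,p}$ and $\mathbf{X}_p$ be $d$-dimensional random vectors with $\mathbf{X}_{n,p}\Longrightarrow\mathbf{X}_p$ uniformly-over-$p$, and let $g:\mathbb{R}^d\to\mathbb{R}$ be a continuous function. Then $g(\mathbf{X}_{n,p})\Longrightarrow g(\mathbf{X}_p)$ uniformly-over-$p$.
   Context: The indices $n$ and $p$ range over the positive integers. For $m$-dimensional random vectors $\mathbf{V}_{n,p}$ and $\mathbf{V}_p$ with distributions $\mu_{n,p}$ and $\mu_p$ on $\mathbb{R}^m$, by definition $\mathbf{V}_{n,p}\Longrightarrow\mathbf{V}_p$ uniformly-over-$p$ means that for every bounded continuous function $f:\mathbb{R}^m\to\mathbb{R}$, $\lim_{n\to\infty}\sup_p\left|\int f\,\mathrm{d}\mu_{n,p}-\int f\,\mathrm{d}\mu_p\right|=0$. *)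

theory Defs
  imports "HOL-Probability.Probability"
begin

text \<open>
  The random vectors \<open>X n p\<close> and \<open>Y p\<close> may live on different probability spaces \<open>M n p\<close> and \<open>N p\<close>;
  only their distributions enter. The indices are positive integers, so the supremum runs over
  \<open>p \<ge> 1\<close>, and the value at \<open>n = 0\<close> is irrelevant for the limit. For probability spaces and
  measurable \<open>X n p\<close>, \<open>Y p\<close> with \<open>n, p \<ge> 1\<close>, the set under the supremum is nonempty and bounded
  above by twice a bound of \<open>\<bar>f\<bar>\<close>, so it is a genuine supremum in the reals.
\<close>

definition weak_conv_uniformly_over ::
  "(nat \<Rightarrow> nat \<Rightarrow> 'a measure) \<Rightarrow> (nat \<Rightarrow> nat \<Rightarrow> 'a \<Rightarrow> 'v::euclidean_space) \<Rightarrow>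
   (nat \<Rightarrow> 'b measure) \<Rightarrow> (nat \<Rightarrow> 'b \<Rightarrow> 'v) \<Rightarrow> bool" where
  "weak_conv_uniformly_over M X N Y \<longleftrightarrow>
    (\<forall>f :: 'v \<Rightarrow> real. continuous_on UNIV f \<longrightarrow> bounded (range f) \<longrightarrow>
      (\<lambda>n. SUP p\<in>{1..}. \<bar>(\<integral>x. f x \<partial>distr (M n p) borel (X n p)) -
                         (\<integral>x. f x \<partial>distr (N p) borel (Y p))\<bar>) \<longlonglongrightarrow> 0)"

end

theory Submission
  imports Defs
begin

text \<open>
  Continuous bounded test functions are closed under composition with a continuous map: if \<open>f\<close> is
  bounded and continuous on the target of \<open>g\<close>, then \<open>f \<circ> g\<close> is bounded and continuous on its
  source. By change of variables, the integral of \<open>f\<close> against the law of \<open>g (X n p)\<close> is the integral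
  of \<open>f \<circ> g\<close> against the law of \<open>X n p\<close>, and likewise for the limits. So, for each \<open>n \<ge> 1\<close>, the
  supremum over \<open>p\<close> that tests the images against \<open>f\<close> is the very same number as the one that tests
  the original vectors against \<open>f \<circ> g\<close>. Uniformity in \<open>p\<close> is inherited at no cost.
\<close>

lemma integral_distr_continuous_image:
  fixes f :: "'w::euclidean_space \<Rightarrow> real" and g :: "'v::euclidean_space \<Rightarrow> 'w"
  assumes Z: "Z \<in> borel_measurable P"
    and g: "continuous_on UNIV g" and f: "continuous_on UNIV f"
  shows "(\<integral>x. f x \<partial>distr P borel (\<lambda>\<omega>. g (Z \<omega>))) = (\<integral>x. f (g x) \<partial>distr P borel Z)"
proof -
  have [measurable]: "f \<in> borel_measurable borel" "g \<in> borel_measurable borel"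
    using f g by (auto intro: borel_measurable_continuous_onI)
  note [measurable] = Z
  show ?thesis
    by (simp add: integral_distr)
qed

theorem theorem5:
  fixes M :: "nat \<Rightarrow> nat \<Rightarrow> 'a measure" and N :: "nat \<Rightarrow> 'b measure"
    and X :: "nat \<Rightarrow> nat \<Rightarrow> 'a \<Rightarrow> real ^ 'd" and Y :: "nat \<Rightarrow> 'b \<Rightarrow> real ^ 'd"
    and g :: "real ^ 'd \<Rightarrow> real"
  assumes "\<And>n p. n \<ge> 1 \<Longrightarrow> p \<ge> 1 \<Longrightarrow> prob_space (M n p)"
    and "\<And>n p. n \<ge> 1 \<Longrightarrow> p \<ge> 1 \<Longrightarrow> X n p \<in> borel_measurable (M n p)"
    and "\<And>p. p \<ge> 1 \<Longrightarrow> prob_space (N p)"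
    and "\<And>p. p \<ge> 1 \<Longrightarrow> Y p \<in> borel_measurable (N p)"
    and "weak_conv_uniformly_over M X N Y"
    and "continuous_on UNIV g"
  shows "weak_conv_uniformly_over M (\<lambda>n p \<omega>. g (X n p \<omega>)) N (\<lambda>p \<omega>. g (Y p \<omega>))"
proof -
  note X = assms(2) and Y = assms(4) and conv = assms(5) and g = assms(6)
  show ?thesis
    unfolding weak_conv_uniformly_over_def
  proof (intro allI impI)
    fix f :: "real \<Rightarrow> real"
    assume f: "continuous_on UNIV f" and bdd: "bounded (range f)"
    have "continuous_on UNIV (\<lambda>x. f (g x))"
      using f g by (auto intro: continuous_on_compose2)
    moreover have "bounded (range (\<lambda>x. f (g x)))"
      using bdd by (rule bounded_subset) auto
    ultimately have lim:
      "(\<lambda>n. SUP p\<in>{1..}. \<bar>(\<integral>x. f (g x) \<partial>distr (M n p) borel (X n p)) -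
                          (\<integral>x. f (g x) \<partial>distr (N p) borel (Y p))\<bar>) \<longlonglongrightarrow> 0"
      using conv unfolding weak_conv_uniformly_over_def by blast
    \<comment> \<open>The suprema need to agree only for \<open>n \<ge> 1\<close>; the case \<open>n = 0\<close> may fail, as \<open>X 0 p\<close> may be non-measurable.\<close>
    have "\<forall>\<^sub>F n in sequentially.
       (SUP p\<in>{1..}. \<bar>(\<integral>x. f (g x) \<partial>distr (M n p) borel (X n p)) -
                      (\<integral>x. f (g x) \<partial>distr (N p) borel (Y p))\<bar>) =
       (SUP p\<in>{1..}. \<bar>(\<integral>x. f x \<partial>distr (M n p) borel (\<lambda>\<omega>. g (X n p \<omega>))) -
                      (\<integral>x. f x \<partial>distr (N p) borel (\<lambda>\<omega>. g (Y p \<omega>)))\<bar>)"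
      using eventually_ge_at_top[of 1]
    proof eventually_elim
      case (elim n)
      then show ?case
        by (intro SUP_cong refl)
           (simp add: integral_distr_continuous_image[OF X g f]
                      integral_distr_continuous_image[OF Y g f])
    qed
    with lim show
      "(\<lambda>n. SUP p\<in>{1..}. \<bar>(\<integral>x. f x \<partial>distr (M n p) borel (\<lambda>\<omega>. g (X n p \<omega>))) -
                          (\<integral>x. f x \<partial>distr (N p) borel (\<lambda>\<omega>. g (Y p \<omega>)))\<bar>) \<longlonglongrightarrow> 0"
      by (rule Lim_transform_eventually)
  qed
qed

end
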